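(* Let $m\geq 1$ be an integer, let $W(v)=\frac14(|v|^2-1)^2$ for $v\in\mathbb{R}^m$, and let $u\in C^2(\mathbb{R};\mathbb{R}^m)$ be a non-constant solution on $\mathbb{R}$ of $$\frac{\mathrm{d}^2u}{\mathrm{d}x^2}=(|u|^2-1)u.$$ Then for every $x\in\mathbb{R}$ one has $|u(x)|<1$ and $$\frac12\left|\frac{\mathrm{d}u}{\mathrm{d}x}(x)\right|^2\leq\begin{cases}|u(x)|^2\sqrt{W(u(x))} & \text{if } |u(x)|^2\geq\frac23,\\[2pt] W(u(x))+\frac1{12} & \text{if } |u(x)|^2\leq\frac23.\end{cases}$$ In other words, the Hamiltonian $H=\frac12|u_x|^2-W(u)$ of $u$ (which is constant in $x$) satisfies $H\leq\frac1{12}$, and if $S:=\sup_{x\in\mathbb{R}}|u(x)|^2>\frac23$, then $H\leq\frac14(1-S)(3S-1)$.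
   Context: $|\cdot|$ is the Euclidean norm on $\mathbb{R}^m$, and $u_x=\frac{\mathrm{d}u}{\mathrm{d}x}$. *)

theory Defs
  imports "HOL-Analysis.Analysis"
begin

definition W :: "real ^ 'm \<Rightarrow> real" where
  "W v = 1/4 * ((norm v)\<^sup>2 - 1)\<^sup>2"

definition ddx :: "(real \<Rightarrow> real ^ 'm) \<Rightarrow> real \<Rightarrow> real ^ 'm" where
  "ddx u x = vector_derivative u (at x)"

text \<open>The first conjunct makes the total operator \<^term>\<open>ddx u\<close> the actual derivative of \<^term>\<open>u\<close>
  everywhere; the second then says that this derivative is itself of class C1.\<close>

definition C2 :: "(real \<Rightarrow> real ^ 'm) \<Rightarrow> bool" where
  "C2 u \<longleftrightarrow> u C1_differentiable_on UNIV \<and> ddx u C1_differentiable_on UNIV"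

definition hamiltonian :: "(real \<Rightarrow> real ^ 'm) \<Rightarrow> real \<Rightarrow> real" where
  "hamiltonian u x = 1/2 * (norm (ddx u x))\<^sup>2 - W (u x)"

end

theory Submission
  imports Defs
begin

text \<open>With $r = |u|^2$ and the constant energy $H$ one has $r'' = 2|u'|^2 + 2r(r-1) = 4H - (1-r)(3r-1)$.
  Since $r - 1$ satisfies $w'' \ge 2w^2$ wherever it is positive, it cannot be positive on an entire
  solution (Keller--Osserman). If $r = 1$ somewhere, then $u' = 0$ and hence $H = 0$ there, and
  $|r'| \le \sqrt 2\,(1-r)$ forces $r = 1$ everywhere, so that $u$ is constant. Finally the maximum
  principle for $r$ at its supremum $S$, perturbed by a small parabola because $S$ need not be attained,
  gives $4H \le (1-S)(3S-1)$; the pointwise bounds follow by monotonicity of $(1-s)(3s-1)$ for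
  $s \ge 2/3$.\<close>

section \<open>Maximum principles on the line\<close>

lemma interior_max_second_derivative:
  fixes f f' f'' :: "real \<Rightarrow> real"
  assumes f: "\<And>x. (f has_real_derivative f' x) (at x)"
    and f': "\<And>x. (f' has_real_derivative f'' x) (at x)"
    and c: "a < c" "c < b" "f a \<le> f c" "f b \<le> f c"
  obtains y where "a < y" "y < b" "f c \<le> f y" "f' y = 0" "f'' y \<le> 0"
proof -
  have "continuous_on {a..b} f"
    using f by (meson DERIV_isCont continuous_at_imp_continuous_on)
  then obtain z where z: "z \<in> {a..b}" "\<And>x. x \<in> {a..b} \<Longrightarrow> f x \<le> f z"
    using continuous_attains_sup[of "{a..b}" f] c by auto
  \<comment> \<open>If the maximum over \<open>{a..b}\<close> sits at an endpoint, the assumptions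
    on \<open>f a\<close> and \<open>f b\<close> make \<open>c\<close> a maximiser as well.\<close>
  define y where "y = (if a < z \<and> z < b then z else c)"
  have y: "a < y" "y < b" and "f z \<le> f y"
    using z c by (auto simp: y_def not_less order.order_iff_strict)
  then have max: "f x \<le> f y" if "x \<in> {a..b}" for x
    using z(2)[OF that] by linarith
  have "f' y = 0"
  proof (rule DERIV_local_max[OF f])
    show "0 < min (y - a) (b - y)" using y by simp
    show "\<forall>x. \<bar>y - x\<bar> < min (y - a) (b - y) \<longrightarrow> f x \<le> f y"
      using max by (auto simp: abs_less_iff)
  qed
  moreover have "f'' y \<le> 0"
  proof (rule ccontr)
    assume "\<not> f'' y \<le> 0"
    then obtain d where d: "d > 0" "\<And>h. 0 < h \<Longrightarrow> h < d \<Longrightarrow> f' y < f' (y + h)"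
      using DERIV_pos_inc_right[OF f'] by (metis not_le)
    \<comment> \<open>With \<open>f'' y > 0\<close>, \<open>f'\<close> is positive just to the right
      of \<open>y\<close>, so by the mean value theorem \<open>f\<close> would exceed its maximum at
      \<open>y + e\<close>.\<close>
    define e where "e = min d (b - y) / 2"
    have e: "0 < e" "e < d" "e < b - y" using d y by (auto simp: e_def min_def)
    then obtain t where t: "y < t" "t < y + e" "f (y + e) - f y = (y + e - y) * f' t"
      using MVT2[of y "y + e" f f'] f by auto
    then have "f' t > 0"
      using d(2)[of "t - y"] e \<open>f' y = 0\<close> by auto
    then have "f (y + e) > f y"
      using t(3) e by (simp add: zero_less_mult_iff algebra_simps)
    then show False
      using max[of "y + e"] e y by auto
  qed
  moreover have "f c \<le> f y" using max c by auto
  ultimately show ?thesis using that y by blast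
qed

text \<open>Maximum principle for \<open>w\<close> times the cutoff \<open>(R\<^sup>2 - t\<^sup>2)\<^sup>2\<close>, letting \<open>R \<rightarrow> \<infinity>\<close>.\<close>

lemma entire_subsolution_nonpos:
  fixes w w' w'' :: "real \<Rightarrow> real"
  assumes w: "\<And>x. (w has_real_derivative w' x) (at x)"
    and w': "\<And>x. (w' has_real_derivative w'' x) (at x)"
    and ineq: "\<And>x. w x > 0 \<Longrightarrow> w'' x \<ge> 2 * (w x)\<^sup>2"
  shows "w p \<le> 0"
proof (rule ccontr)
  assume "\<not> w p \<le> 0"
  then have wp: "w p > 0" by simp
  \<comment> \<open>The estimate below yields \<open>w p * R\<^sup>2 \<le> 12\<close>; any constant
    above 12 contradicts it.\<close>
  define R where "R = sqrt (13 / w p)"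
  have R: "R > 0" and R2: "R\<^sup>2 * w p = 13" using wp by (auto simp: R_def)
  let ?q = "\<lambda>x. R\<^sup>2 - (x - p)\<^sup>2"
  define f where "f x = w x * (?q x)\<^sup>2" for x
  define f' where "f' x = w' x * (?q x)\<^sup>2 - 4 * w x * (x - p) * ?q x" for x
  define f'' where "f'' x = w'' x * (?q x)\<^sup>2 - 8 * w' x * (x - p) * ?q x
      + w x * (8 * (x - p)\<^sup>2 - 4 * ?q x)" for x
  have "(f has_real_derivative f' x) (at x)" for x
    unfolding f_def f'_def
    by (auto intro!: derivative_eq_intros w simp: algebra_simps power2_eq_square)
  moreover have "(f' has_real_derivative f'' x) (at x)" for x
    unfolding f'_def f''_def
    by (auto intro!: derivative_eq_intros w w' simp: algebra_simps power2_eq_square)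
  moreover have "f (p - R) \<le> f p" "f (p + R) \<le> f p"
    using wp by (auto simp: f_def)
  ultimately obtain y where y: "p - R < y" "y < p + R" "f p \<le> f y" "f' y = 0" "f'' y \<le> 0"
    using interior_max_second_derivative[of f f' f'' "p - R" p "p + R"] R by auto
  define t Q where "t = y - p" and "Q = R\<^sup>2 - t\<^sup>2"
  have t: "t\<^sup>2 < R\<^sup>2" using y R by (intro power2_strict_mono) (auto simp: t_def)
  then have Q: "Q > 0" by (simp add: Q_def)
  have "0 < w p * (R\<^sup>2)\<^sup>2" using wp R by simp
  then have "w y * Q\<^sup>2 > 0" using y(3) by (simp add: f_def Q_def t_def)
  then have wy: "w y > 0" using Q by (simp add: zero_less_mult_iff)
  \<comment> \<open>\<open>f' y = 0\<close> eliminates \<open>w'\<close> from the second-order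
    condition.\<close>
  have crit: "w' y * Q = 4 * w y * t"
  proof -
    have "w' y * Q\<^sup>2 - 4 * w y * t * Q = 0"
      using y(4) by (simp add: f'_def Q_def t_def)
    then have "(w' y * Q - 4 * w y * t) * Q = 0"
      by (simp only: power2_eq_square left_diff_distrib mult.assoc)
    then show ?thesis using Q by simp
  qed
  \<comment> \<open>The squared cutoff matches the quadratic nonlinearity: after cancelling one
    factor \<open>w y\<close>, the left side is \<open>2 * f y\<close>, which dominates
    \<open>2 * f p\<close>.\<close>
  have "2 * (w y)\<^sup>2 * Q\<^sup>2 \<le> w'' y * Q\<^sup>2"
    using ineq[OF wy] by (simp add: mult_right_mono)
  also have "\<dots> \<le> 8 * t * (w' y * Q) - w y * (8 * t\<^sup>2 - 4 * Q)"
    using y(5) by (simp add: f''_def flip: Q_def t_def) (simp add: algebra_simps)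
  also have "\<dots> = w y * (24 * t\<^sup>2 + 4 * Q)"
    unfolding crit by (simp add: algebra_simps power2_eq_square)
  finally have "w y * (2 * (w y * Q\<^sup>2)) \<le> w y * (24 * t\<^sup>2 + 4 * Q)"
    by (simp add: algebra_simps power2_eq_square)
  then have "2 * (w y * Q\<^sup>2) \<le> 24 * t\<^sup>2 + 4 * Q"
    using wy by simp
  also have "\<dots> \<le> 24 * R\<^sup>2" using t unfolding Q_def by simp
  finally have "w p * (R\<^sup>2)\<^sup>2 \<le> 12 * R\<^sup>2"
    using y(3) by (simp add: f_def Q_def t_def)
  moreover have "w p * (R\<^sup>2)\<^sup>2 = 13 * R\<^sup>2"
    using R2 by (simp add: power2_eq_square mult.commute mult.left_commute)
  moreover have "R\<^sup>2 > 0" using R by simp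
  ultimately show False by linarith
qed

section \<open>The equation as a first-order system, and its energy\<close>

locale allen_cahn_solution =
  fixes u v :: "real \<Rightarrow> 'a::real_inner"
  assumes u: "\<And>x. (u has_vector_derivative v x) (at x)"
    and v: "\<And>x. (v has_vector_derivative ((norm (u x))\<^sup>2 - 1) *\<^sub>R u x) (at x)"
begin

definition r :: "real \<Rightarrow> real" where "r x = (norm (u x))\<^sup>2"

definition H :: real where "H = 1/2 * (norm (v 0))\<^sup>2 - 1/4 * (r 0 - 1)\<^sup>2"

lemma r_nonneg: "0 \<le> r x"
  by (simp add: r_def)

lemma DERIV_r: "(r has_real_derivative 2 * (u x \<bullet> v x)) (at x)"
proof -
  have "((\<lambda>x. u x \<bullet> u x) has_derivative (\<lambda>h. u x \<bullet> (h *\<^sub>R v x) + (h *\<^sub>R v x) \<bullet> u x)) (at x)"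
    using u[of x] unfolding has_vector_derivative_def by (intro has_derivative_inner)
  then show ?thesis
    unfolding has_field_derivative_def r_def power2_norm_eq_inner
    by (rule has_derivative_eq_rhs) (auto simp: inner_commute)
qed

text \<open>Twice this derivative is the second derivative of \<open>r\<close>.\<close>

lemma DERIV_inner_u_v:
  "((\<lambda>x. u x \<bullet> v x) has_real_derivative (norm (v x))\<^sup>2 + (r x - 1) * r x) (at x)"
proof -
  have "((\<lambda>x. u x \<bullet> v x) has_derivative
      (\<lambda>h. u x \<bullet> (h *\<^sub>R ((norm (u x))\<^sup>2 - 1) *\<^sub>R u x) + (h *\<^sub>R v x) \<bullet> v x)) (at x)"
    using u[of x] v[of x] unfolding has_vector_derivative_def by (intro has_derivative_inner)
  then show ?thesis
    unfolding has_field_derivative_def r_def power2_norm_eq_inner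
    by (rule has_derivative_eq_rhs) (auto simp: fun_eq_iff algebra_simps)
qed

text \<open>Pairing the equation with \<open>v\<close> gives
  \<open>(r x - 1) * (u x \<bullet> v x)\<close> as the derivative of both the kinetic and the
  potential term, so they cancel.\<close>

lemma energy: "1/2 * (norm (v x))\<^sup>2 - 1/4 * (r x - 1)\<^sup>2 = H"
proof -
  have "((\<lambda>x. v x \<bullet> v x) has_real_derivative 2 * (r x - 1) * (u x \<bullet> v x)) (at x)" for x
  proof -
    have "((\<lambda>x. v x \<bullet> v x) has_derivative
        (\<lambda>h. v x \<bullet> (h *\<^sub>R ((norm (u x))\<^sup>2 - 1) *\<^sub>R u x)
           + (h *\<^sub>R ((norm (u x))\<^sup>2 - 1) *\<^sub>R u x) \<bullet> v x)) (at x)"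
      using v[of x] unfolding has_vector_derivative_def by (intro has_derivative_inner)
    then show ?thesis
      unfolding has_field_derivative_def r_def
      by (rule has_derivative_eq_rhs) (auto simp: fun_eq_iff inner_commute)
  qed
  then have "((\<lambda>x. 1/2 * (v x \<bullet> v x) - 1/4 * (r x - 1)\<^sup>2) has_real_derivative 0) (at x)" for x
    by (auto intro!: derivative_eq_intros DERIV_r)
  then have "1/2 * (v x \<bullet> v x) - 1/4 * (r x - 1)\<^sup>2 = 1/2 * (v 0 \<bullet> v 0) - 1/4 * (r 0 - 1)\<^sup>2"
    by (intro DERIV_isconst_all[of "\<lambda>x. 1/2 * (v x \<bullet> v x) - 1/4 * (r x - 1)\<^sup>2"]) auto
  then show ?thesis
    by (simp add: H_def power2_norm_eq_inner)
qed

section \<open>The bound |u| < 1\<close>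

lemma r_le_1: "r x \<le> 1"
proof -
  have "r x - 1 \<le> 0"
  proof (rule entire_subsolution_nonpos[of "\<lambda>x. r x - 1"])
    show "((\<lambda>x. r x - 1) has_real_derivative 2 * (u x \<bullet> v x)) (at x)" for x
      by (auto intro!: derivative_eq_intros DERIV_r)
    show "((\<lambda>x. 2 * (u x \<bullet> v x)) has_real_derivative 2 * ((norm (v x))\<^sup>2 + (r x - 1) * r x)) (at x)" for x
      by (intro DERIV_cmult DERIV_inner_u_v)
    show "2 * (r x - 1)\<^sup>2 \<le> 2 * ((norm (v x))\<^sup>2 + (r x - 1) * r x)" if "0 < r x - 1" for x
    proof -
      have "(r x - 1)\<^sup>2 \<le> (r x - 1) * r x"
        using that by (simp add: power2_eq_square)
      then show ?thesis by (simp add: add_increasing)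
    qed
  qed
  then show ?thesis by simp
qed

text \<open>Constant unit vectors solve the equation with \<open>r = 1\<close>; the proof shows that
  touching the value 1 forces this case.\<close>

lemma r_less_1:
  assumes "\<not> u constant_on UNIV"
  shows "r p < 1"
proof (rule ccontr)
  assume "\<not> r p < 1"
  then have rp: "r p = 1" using r_le_1[of p] by simp
  \<comment> \<open>As 1 is the largest possible value of \<open>r\<close>, the point
    \<open>y\<close> also has \<open>r y = 1\<close>, and the second-order condition reduces to
    \<open>v y = 0\<close>.\<close>
  obtain y where y: "r p \<le> r y" "2 * ((norm (v y))\<^sup>2 + (r y - 1) * r y) \<le> 0"
    by (rule interior_max_second_derivative
        [OF DERIV_r DERIV_cmult[OF DERIV_inner_u_v, of 2], of "p - 1" p "p + 1"])
      (use rp r_le_1 in auto)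
  then have "r y = 1" "v y = 0" using rp r_le_1[of y] by auto
  then have H0: "H = 0" using energy[of y] by simp
  \<comment> \<open>At zero energy the kinetic and potential terms are equal.\<close>
  have vnorm: "norm (v x) = (1 - r x) / sqrt 2" for x
  proof (rule power2_eq_imp_eq)
    show "(norm (v x))\<^sup>2 = ((1 - r x) / sqrt 2)\<^sup>2"
      using energy[of x] H0 by (simp add: power_divide power2_commute[of 1])
  qed (use r_le_1[of x] in auto)
  have bound: "\<bar>2 * (u x \<bullet> v x)\<bar> \<le> sqrt 2 * (1 - r x)" for x
  proof -
    have "norm (u x) \<le> 1" using r_le_1[of x] by (simp add: r_def power_le_one_iff)
    then have "\<bar>u x \<bullet> v x\<bar> \<le> norm (v x)"
      using Cauchy_Schwarz_ineq2[of "u x" "v x"] by (smt (verit) mult_left_le_one_le norm_ge_zero)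
    moreover have "2 * norm (v x) = 2 / sqrt 2 * (1 - r x)"
      using vnorm[of x] by simp
    then have "2 * norm (v x) = sqrt 2 * (1 - r x)"
      by (simp only: real_div_sqrt)
    ultimately show ?thesis by simp
  qed
  have "r x = 1" for x
  proof (cases "p \<le> x")
    case True
    \<comment> \<open>Gronwall: \<open>bound\<close> makes this weighted quantity nonincreasing, and
      it is 0 at \<open>p\<close>. To the left of \<open>p\<close> the opposite exponent
      serves.\<close>
    have "(1 - r x) * exp (- sqrt 2 * x) \<le> (1 - r p) * exp (- sqrt 2 * p)"
    proof (rule DERIV_nonpos_imp_nonincreasing[OF True])
      fix x
      have "((\<lambda>x. (1 - r x) * exp (- sqrt 2 * x)) has_real_derivative
          (- (2 * (u x \<bullet> v x)) - sqrt 2 * (1 - r x)) * exp (- sqrt 2 * x)) (at x)"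
        by (rule derivative_eq_intros DERIV_r refl | simp)+ (simp add: algebra_simps)
      moreover have "(- (2 * (u x \<bullet> v x)) - sqrt 2 * (1 - r x)) * exp (- sqrt 2 * x) \<le> 0"
        using bound[of x] by (intro mult_nonpos_nonneg) auto
      ultimately show "\<exists>d. ((\<lambda>x. (1 - r x) * exp (- sqrt 2 * x)) has_real_derivative d) (at x) \<and> d \<le> 0"
        by blast
    qed
    then show ?thesis using rp r_le_1[of x] by (simp add: mult_le_0_iff)
  next
    case False
    then have "x \<le> p" by simp
    have "(1 - r x) * exp (sqrt 2 * x) \<le> (1 - r p) * exp (sqrt 2 * p)"
    proof (rule DERIV_nonneg_imp_nondecreasing[OF \<open>x \<le> p\<close>])
      fix x
      have "((\<lambda>x. (1 - r x) * exp (sqrt 2 * x)) has_real_derivative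
          (- (2 * (u x \<bullet> v x)) + sqrt 2 * (1 - r x)) * exp (sqrt 2 * x)) (at x)"
        by (rule derivative_eq_intros DERIV_r refl | simp)+ (simp add: algebra_simps)
      moreover have "0 \<le> (- (2 * (u x \<bullet> v x)) + sqrt 2 * (1 - r x)) * exp (sqrt 2 * x)"
        using bound[of x] by (intro mult_nonneg_nonneg) auto
      ultimately show "\<exists>d. ((\<lambda>x. (1 - r x) * exp (sqrt 2 * x)) has_real_derivative d) (at x) \<and> 0 \<le> d"
        by blast
    qed
    then show ?thesis using rp r_le_1[of x] by (simp add: mult_le_0_iff)
  qed
  then have "(u has_vector_derivative 0) (at x)" for x
    using u[of x] vnorm[of x] by simp
  then obtain c where "\<And>x. u x = c"
    using has_vector_derivative_zero_constant[of UNIV u] by auto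
  then have "u constant_on UNIV" by (auto simp: constant_on_def)
  with assms show False by blast
qed

section \<open>Upper bounds for the energy\<close>

lemma H_le_sup:
  defines "S \<equiv> SUP x. r x"
  shows "4 * H \<le> (1 - S) * (3 * S - 1)"
proof (rule field_le_epsilon)
  fix e :: real
  assume e: "e > 0"
  have bdd: "bdd_above (range r)" using r_le_1 by (auto intro!: bdd_aboveI)
  have rS: "r x \<le> S" for x unfolding S_def by (rule cSUP_upper[OF _ bdd]) simp
  have S1: "S \<le> 1" unfolding S_def by (rule cSUP_least) (auto simp: r_le_1)
  obtain p where p: "S - e / 4 < r p"
    using less_cSUP_iff[OF _ bdd, of "S - e / 4"] e by (auto simp: S_def)
  \<comment> \<open>The parabola costs \<open>2 * k = e / 2\<close>, and the gap
    \<open>S - r y < e / 4\<close> costs at most another \<open>e / 2\<close>.\<close>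
  define k where "k = e / 4"
  \<comment> \<open>At \<open>p - L\<close> and \<open>p + L\<close> the penalty equals 1, so the
    penalised function is at most 0 there, hence at most \<open>r p\<close>.\<close>
  define L where "L = sqrt (1 / k)"
  have L: "L > 0" "k * L\<^sup>2 = 1" using e by (auto simp: L_def k_def)
  have "((\<lambda>x. r x - k * (x - p)\<^sup>2) has_real_derivative 2 * (u x \<bullet> v x) - 2 * k * (x - p)) (at x)" for x
    by (rule derivative_eq_intros DERIV_r refl | simp)+
  moreover have "((\<lambda>x. 2 * (u x \<bullet> v x) - 2 * k * (x - p)) has_real_derivative
      2 * ((norm (v x))\<^sup>2 + (r x - 1) * r x) - 2 * k) (at x)" for x
    by (rule derivative_eq_intros DERIV_inner_u_v refl | simp)+
  ultimately obtain y where y: "r p - k * (p - p)\<^sup>2 \<le> r y - k * (y - p)\<^sup>2"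
      "2 * ((norm (v y))\<^sup>2 + (r y - 1) * r y) - 2 * k \<le> 0"
    by (rule interior_max_second_derivative[of _ _ _ "p - L" p "p + L"])
      (use L r_le_1[of "p - L"] r_le_1[of "p + L"] r_nonneg[of p] in auto)
  have "k * (y - p)\<^sup>2 \<ge> 0" using e by (simp add: k_def)
  then have ry: "S - e / 4 < r y" using y(1) p by simp
  have "4 * H = 2 * (norm (v y))\<^sup>2 - (r y - 1)\<^sup>2" using energy[of y] by simp
  also have "\<dots> \<le> 2 * k - 2 * ((r y - 1) * r y) - (r y - 1)\<^sup>2" using y(2) by simp
  \<comment> \<open>With g(s) = (1-s)(3s-1), the last product is g(r y) - g(S); its second factor is
    at most 2 because both arguments are at most 1.\<close>
  also have "\<dots> = 2 * k + (1 - S) * (3 * S - 1) + (S - r y) * (3 * (S + r y) - 4)"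
    by (simp add: algebra_simps power2_eq_square)
  also have "(S - r y) * (3 * (S + r y) - 4) \<le> (S - r y) * 2"
    using rS[of y] S1 by (intro mult_left_mono) auto
  finally show "4 * H \<le> (1 - S) * (3 * S - 1) + e"
    using ry by (simp add: k_def)
qed

text \<open>The parabola (1-s)(3s-1) has its maximum 1/3 at s = 2/3, which is where the threshold in
  the theorem comes from.\<close>

lemma H_le: "H \<le> 1/12"
proof -
  let ?S = "SUP x. r x"
  have "(1 - ?S) * (3 * ?S - 1) \<le> 1/3"
    using zero_le_power2[of "3 * ?S - 2"] by (simp add: algebra_simps power2_eq_square)
  then show ?thesis using H_le_sup by simp
qed

lemma H_le_pointwise:
  assumes "2/3 \<le> r x"
  shows "4 * H \<le> (1 - r x) * (3 * r x - 1)"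
proof -
  let ?S = "SUP x. r x"
  have "r x \<le> ?S"
    using r_le_1 by (intro cSUP_upper) (auto intro!: bdd_aboveI)
  \<comment> \<open>This product is the value of (1-s)(3s-1) at \<open>r x\<close> minus that at
    \<open>?S\<close>; the second factor is nonnegative since both points are at least 2/3.\<close>
  then have "0 \<le> (?S - r x) * (3 * (?S + r x) - 4)"
    using assms by (intro mult_nonneg_nonneg) auto
  then have "(1 - ?S) * (3 * ?S - 1) \<le> (1 - r x) * (3 * r x - 1)"
    by (simp add: algebra_simps)
  then show ?thesis using H_le_sup by simp
qed

end

section \<open>Translation to \<open>ddx\<close>, \<open>W\<close> and
  \<open>hamiltonian\<close>\<close>

theorem theorem3p4:
  fixes u :: "real \<Rightarrow> real ^ 'm"
  assumes C2: "C2 u"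
    and ode: "\<And>x. ddx (ddx u) x = ((norm (u x))\<^sup>2 - 1) *\<^sub>R u x"
    and nonconst: "\<not> u constant_on UNIV"
  shows "(\<forall>x. norm (u x) < 1 \<and>
           ((norm (u x))\<^sup>2 \<ge> 2/3 \<longrightarrow>
              1/2 * (norm (ddx u x))\<^sup>2 \<le> (norm (u x))\<^sup>2 * sqrt (W (u x))) \<and>
           ((norm (u x))\<^sup>2 \<le> 2/3 \<longrightarrow>
              1/2 * (norm (ddx u x))\<^sup>2 \<le> W (u x) + 1/12)) \<and>
         (\<exists>H. (\<forall>x. hamiltonian u x = H) \<and> H \<le> 1/12 \<and>
           (let S = (SUP x. (norm (u x))\<^sup>2)
            in S > 2/3 \<longrightarrow> H \<le> 1/4 * (1 - S) * (3 * S - 1)))"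
proof -
  have deriv: "(f has_vector_derivative ddx f x) (at x)"
    if "f C1_differentiable_on UNIV" for f :: "real \<Rightarrow> real ^ 'm" and x
    using that by (simp add: C1_differentiable_on_eq ddx_def flip: vector_derivative_works)
  interpret allen_cahn_solution u "ddx u"
  proof
    show "(u has_vector_derivative ddx u x) (at x)" for x
      using C2 deriv by (auto simp: C2_def)
    show "(ddx u has_vector_derivative ((norm (u x))\<^sup>2 - 1) *\<^sub>R u x) (at x)" for x
      using C2 deriv[of "ddx u" x] by (auto simp: C2_def ode)
  qed
  have W: "W (u x) = 1/4 * (r x - 1)\<^sup>2" for x
    by (simp add: W_def r_def)
  have ham: "hamiltonian u x = H" for x
    using energy[of x] by (simp add: hamiltonian_def W)
  have kin: "1/2 * (norm (ddx u x))\<^sup>2 = H + 1/4 * (1 - r x)\<^sup>2" for x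
    using energy[of x] by (simp add: power2_commute)
  have "norm (u x) < 1" for x
    using r_less_1[OF nonconst, of x] by (simp add: r_def power_less_one_iff)
  moreover have "1/2 * (norm (ddx u x))\<^sup>2 \<le> r x * sqrt (W (u x))" if "2/3 \<le> r x" for x
  proof -
    \<comment> \<open>\<open>r x \<le> 1\<close> fixes the sign of the root.\<close>
    have sqrt_W: "sqrt (W (u x)) = (1 - r x) / 2"
      using r_le_1[of x] by (intro real_sqrt_unique) (auto simp: W power_divide power2_commute)
    show ?thesis
      \<comment> \<open>The claim is now
        \<open>H + (1 - r x)\<^sup>2 / 4 \<le> r x * (1 - r x) / 2\<close>, a rearrangement of
        \<open>H_le_pointwise\<close>.\<close>
      unfolding kin sqrt_W
      using H_le_pointwise[OF that] by (simp add: algebra_simps power2_eq_square)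
  qed
  moreover have "1/2 * (norm (ddx u x))\<^sup>2 \<le> W (u x) + 1/12" for x
    unfolding kin W using H_le by (simp add: power2_commute)
  moreover have "H \<le> 1/4 * (1 - S) * (3 * S - 1)" if "S = (SUP x. r x)" for S
    using H_le_sup by (simp add: that)
  ultimately show ?thesis
    using ham H_le unfolding r_def Let_def by blast
qed

end
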